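(* Let $\varphi$ be a Musielak--Orlicz function on $\Omega\times[0,\infty)$ which is of uniformly lower type $p_\varphi^-$ for some $p_\varphi^-\in(0,\infty)$ and of uniformly upper type $p_\varphi^+$ for some $p_\varphi^+\in(0,\infty)$, and such that $\int_\Omega\varphi(x,t)\,d\mathbb P(x)<\infty$ for every $t\in(0,\infty)$. Let $h$ be a measurable function on $\Omega$ and $\{h_n\}_{n\in\mathbb N}\subset WL_\varphi(\Omega)$ a sequence of measurable functions such that $h_n(x)$ converges to $h(x)$ for almost every $x\in\Omega$ as $n\to\infty$. If there exists a positive constant $M$ such that, for any $n\in\mathbb N$, $|h_n(x)|\le M$ for almost every $x\in\Omega$, then $$\lim_{n\to\infty}\|h_n-h\|_{WL_\varphi(\Omega)}=0.$$
   Context: $(\Omega,\mathcal F,\mathbb P)$ is a probability space. $\varphi:\Omega\times[0,\infty)\to[0,\infty)$ is a Musielak--Orlicz function if $\varphi(\cdot,t)$ is measurable for each $t\in[0,\infty)$ and, for each $x\in\Omega$, $\varphi(x,\cdot)$ is non-decreasing, $\varphi(x,0)=0$, $\varphi(x,t)>0$ for $t\in(0,\infty)$, and $\lim_{t\to\infty}\varphi(x,t)=\infty$. It is of uniformly lower (resp. upper) type $p\in(0,\infty)$ if there is a constant $C_{(p)}>0$ with $\varphi(x,st)\le C_{(p)}s^p\varphi(x,t)$ for all $x\in\Omega$, $t\in[0,\infty)$ and $s\in(0,1)$ (resp. $s\in[1,\infty)$). For measurable $E\subseteq\Omega$, $\varphi(E,t):=\int_E\varphi(x,t)\,d\mathbb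 P(x)$. For measurable $f$, $\|f\|_{WL_\varphi(\Omega)}:=\inf\{\lambda\in(0,\infty):\ \sup_{\alpha\in(0,\infty)}\varphi(\{x\in\Omega:|f(x)|>\alpha\},\alpha/\lambda)\le1\}$, and $WL_\varphi(\Omega)$ is the set of measurable $f$ with $\|f\|_{WL_\varphi(\Omega)}<\infty$. *)

theory Defs
  imports "HOL-Probability.Probability"
begin

text \<open>A function on \<open>\<Omega> \<times> [0,\<infinity>)\<close> is represented by
  \<open>\<phi> :: 'a \<Rightarrow> real \<Rightarrow> real\<close>; only its values at points of
  \<open>space M\<close> and at \<open>t \<ge> 0\<close> matter. Its nonnegativity there follows from
  \<open>\<phi> x 0 = 0\<close> and positivity on \<open>(0,\<infinity>)\<close>.\<close>

definition musielak_orlicz :: "'a measure \<Rightarrow> ('a \<Rightarrow> real \<Rightarrow> real) \<Rightarrow> bool" where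
  "musielak_orlicz M \<phi> \<longleftrightarrow>
     (\<forall>t\<ge>0. (\<lambda>x. \<phi> x t) \<in> borel_measurable M) \<and>
     (\<forall>x\<in>space M. mono_on {0..} (\<phi> x) \<and> \<phi> x 0 = 0 \<and> (\<forall>t>0. \<phi> x t > 0) \<and>
        filterlim (\<phi> x) at_top at_top)"

definition uniformly_lower_type :: "'a measure \<Rightarrow> ('a \<Rightarrow> real \<Rightarrow> real) \<Rightarrow> real \<Rightarrow> bool" where
  "uniformly_lower_type M \<phi> p \<longleftrightarrow>
     (\<exists>C>0. \<forall>x\<in>space M. \<forall>t\<ge>0. \<forall>s\<in>{0<..<1}. \<phi> x (s * t) \<le> C * s powr p * \<phi> x t)"

definition uniformly_upper_type :: "'a measure \<Rightarrow> ('a \<Rightarrow> real \<Rightarrow> real) \<Rightarrow> real \<Rightarrow> bool" where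
  "uniformly_upper_type M \<phi> p \<longleftrightarrow>
     (\<exists>C>0. \<forall>x\<in>space M. \<forall>t\<ge>0. \<forall>s\<ge>1. \<phi> x (s * t) \<le> C * s powr p * \<phi> x t)"

definition mo_measure :: "'a measure \<Rightarrow> ('a \<Rightarrow> real \<Rightarrow> real) \<Rightarrow> 'a set \<Rightarrow> real \<Rightarrow> ennreal" where
  "mo_measure M \<phi> E t = (\<integral>\<^sup>+x\<in>E. ennreal (\<phi> x t) \<partial>M)"

text \<open>The quasi-norm takes values in \<open>[0,\<infinity>]\<close>; an infimum over the empty set is
  \<open>\<infinity>\<close>, as in the usual convention.\<close>

definition wl_norm :: "'a measure \<Rightarrow> ('a \<Rightarrow> real \<Rightarrow> real) \<Rightarrow> ('a \<Rightarrow> real) \<Rightarrow> ennreal" where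
  "wl_norm M \<phi> f =
     (INF l\<in>{l. 0 < l \<and>
        (SUP \<alpha>\<in>{0<..}. mo_measure M \<phi> {x \<in> space M. \<bar>f x\<bar> > \<alpha>} (\<alpha> / l)) \<le> 1}. ennreal l)"

definition wl_space :: "'a measure \<Rightarrow> ('a \<Rightarrow> real \<Rightarrow> real) \<Rightarrow> ('a \<Rightarrow> real) set" where
  "wl_space M \<phi> = {f \<in> borel_measurable M. wl_norm M \<phi> f < \<infinity>}"

end

theory Submission
  imports Defs
begin

text \<open>Since \<open>|hn n - h| \<le> 2 K\<close> almost everywhere, the lower type inequality with
  \<open>s = \<alpha> / (2 K)\<close> bounds \<open>\<phi> x (\<alpha> / l)\<close> on \<open>{|hn n - h| > \<alpha>}\<close> by
  \<open>C * (|hn n - h| / (2 K)) powr p * \<phi> x (2 K / l)\<close>. This bound no longer depends on \<open>\<alpha>\<close>,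
  and by dominated convergence its integral tends to 0. Unlike \<open>\<phi> x (|hn n x - h x| / l)\<close>,
  which need not be measurable in \<open>x\<close>, it is evaluated at a constant second argument.\<close>

lemma musielak_orlicz_measurable:
  "musielak_orlicz M \<phi> \<Longrightarrow> t \<ge> 0 \<Longrightarrow> (\<lambda>x. \<phi> x t) \<in> borel_measurable M"
  by (simp add: musielak_orlicz_def)

lemma musielak_orlicz_nonneg:
  assumes "musielak_orlicz M \<phi>" "x \<in> space M" "t \<ge> 0"
  shows "\<phi> x t \<ge> 0"
  using assms by (cases "t = 0") (auto simp: musielak_orlicz_def less_imp_le)

lemma wl_norm_le:
  assumes "l > 0"
    and "\<And>\<alpha>. \<alpha> > 0 \<Longrightarrow> mo_measure M \<phi> {x \<in> space M. \<bar>f x\<bar> > \<alpha>} (\<alpha> / l) \<le> 1"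
  shows "wl_norm M \<phi> f \<le> ennreal l"
  unfolding wl_norm_def using assms by (intro INF_lower) (auto intro!: SUP_least)

lemma lower_type_superlevel_le:
  fixes p C :: real
  assumes mo: "musielak_orlicz M \<phi>"
    and C: "C > 0" "\<forall>x\<in>space M. \<forall>t\<ge>0. \<forall>s\<in>{0<..<1}. \<phi> x (s * t) \<le> C * s powr p * \<phi> x t"
    and pos: "p > 0" "B > 0" "l > 0" "\<alpha> > 0"
    and bound: "AE x in M. \<bar>f x\<bar> \<le> B"
  shows "mo_measure M \<phi> {x \<in> space M. \<bar>f x\<bar> > \<alpha>} (\<alpha> / l)
    \<le> (\<integral>\<^sup>+x. ennreal (C * (\<bar>f x\<bar> / B) powr p * \<phi> x (B / l)) \<partial>M)"
  unfolding mo_measure_def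
proof (rule nn_integral_mono_AE)
  show "AE x in M. ennreal (\<phi> x (\<alpha> / l)) * indicator {x \<in> space M. \<bar>f x\<bar> > \<alpha>} x
      \<le> ennreal (C * (\<bar>f x\<bar> / B) powr p * \<phi> x (B / l))"
    using bound AE_space
  proof eventually_elim
    case (elim x)
    show ?case
    proof (cases "\<bar>f x\<bar> > \<alpha>")
      case True
      have "\<phi> x (\<alpha> / l) = \<phi> x ((\<alpha> / B) * (B / l))"
        using pos by simp
      \<comment> \<open>Here \<open>\<alpha> < \<bar>f x\<bar> \<le> B\<close>, so
        \<open>\<alpha> / B\<close> lies strictly between 0 and 1, as the lower type inequality
        demands. For \<open>\<alpha> \<ge> B\<close> the superlevel set is null, so the almost
        everywhere estimate covers that range too.\<close>
      also have "\<dots> \<le> C * (\<alpha> / B) powr p * \<phi> x (B / l)"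
        using C(2)[rule_format, of x "B / l" "\<alpha> / B"] elim True pos by auto
      \<comment> \<open>As \<open>p > 0\<close>, the power is increasing in its base, so \<alpha>
        may be replaced by the larger \<open>\<bar>f x\<bar>\<close>.\<close>
      also have "\<dots> \<le> C * (\<bar>f x\<bar> / B) powr p * \<phi> x (B / l)"
        using True pos C(1) musielak_orlicz_nonneg[OF mo elim(2), of "B / l"]
        by (intro mult_right_mono mult_left_mono powr_mono2 divide_right_mono) auto
      finally show ?thesis
        using True elim by (simp add: ennreal_leI)
    qed simp
  qed
qed

text \<open>Since \<open>\<bar>f n x\<bar> / B \<le> 1\<close> almost everywhere, the integrands are
  dominated by \<open>C * \<phi> x t\<close>, which is integrable by \<open>fin\<close>. They tend
  to 0 pointwise because the exponent is positive and \<open>\<phi> x t\<close> is a fixed real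
  factor for each \<open>x\<close>.\<close>

lemma lower_type_bound_tendsto_0:
  fixes p C :: real and f :: "nat \<Rightarrow> 'a \<Rightarrow> real"
  assumes mo: "musielak_orlicz M \<phi>"
    and fin: "(\<integral>\<^sup>+x. ennreal (\<phi> x t) \<partial>M) < \<infinity>"
    and pos: "p > 0" "C > 0" "B > 0" "t > 0"
    and meas: "\<And>n. f n \<in> borel_measurable M"
    and lim: "AE x in M. (\<lambda>n. f n x) \<longlonglongrightarrow> 0"
    and bound: "\<And>n. AE x in M. \<bar>f n x\<bar> \<le> B"
  shows "(\<lambda>n. \<integral>\<^sup>+x. ennreal (C * (\<bar>f n x\<bar> / B) powr p * \<phi> x t) \<partial>M) \<longlonglongrightarrow> 0"
proof -
  note [measurable] = meas
  have [measurable]: "(\<lambda>x. \<phi> x t) \<in> borel_measurable M"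
    using musielak_orlicz_measurable[OF mo] pos by simp
  have "(\<lambda>n. \<integral>\<^sup>+x. ennreal (C * (\<bar>f n x\<bar> / B) powr p * \<phi> x t) \<partial>M) \<longlonglongrightarrow> (\<integral>\<^sup>+x. 0 \<partial>M)"
  proof (rule nn_integral_dominated_convergence)
    show "AE x in M. ennreal (C * (\<bar>f n x\<bar> / B) powr p * \<phi> x t) \<le> ennreal C * ennreal (\<phi> x t)" for n
      using bound[of n] AE_space
    proof eventually_elim
      case (elim x)
      have "(\<bar>f n x\<bar> / B) powr p \<le> 1 powr p"
        using elim pos by (intro powr_mono2) auto
      then have "C * (\<bar>f n x\<bar> / B) powr p * \<phi> x t \<le> C * \<phi> x t"
        using pos musielak_orlicz_nonneg[OF mo elim(2), of t]
        by (intro mult_right_mono) auto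
      then show ?case
        using pos by (simp add: ennreal_leI flip: ennreal_mult')
    qed
    show "(\<integral>\<^sup>+x. ennreal C * ennreal (\<phi> x t) \<partial>M) < \<infinity>"
      using fin by (subst nn_integral_cmult) (auto simp: ennreal_mult_less_top)
    show "AE x in M. (\<lambda>n. ennreal (C * (\<bar>f n x\<bar> / B) powr p * \<phi> x t)) \<longlonglongrightarrow> 0"
      using lim
    proof eventually_elim
      case (elim x)
      have "(\<lambda>n. \<bar>f n x\<bar> / B) \<longlonglongrightarrow> 0"
        using tendsto_divide[OF tendsto_rabs[OF elim] tendsto_const[of B]] pos by simp
      then have "(\<lambda>n. (\<bar>f n x\<bar> / B) powr p) \<longlonglongrightarrow> 0"
        using pos by (intro tendsto_zero_powrI[where b = p]) auto
      then have "(\<lambda>n. C * (\<bar>f n x\<bar> / B) powr p * \<phi> x t) \<longlonglongrightarrow> 0"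
        by (intro tendsto_mult_left_zero tendsto_mult_right_zero)
      then show ?case
        using tendsto_ennrealI by fastforce
    qed
  qed measurable
  then show ?thesis by simp
qed

theorem theorem5p8:
  fixes M :: "'a measure"
    and \<phi> :: "'a \<Rightarrow> real \<Rightarrow> real"
    and h :: "'a \<Rightarrow> real"
    and hn :: "nat \<Rightarrow> 'a \<Rightarrow> real"
    and p_lo p_up K :: real
  assumes "prob_space M"
    and "musielak_orlicz M \<phi>"
    and "p_lo > 0" and "uniformly_lower_type M \<phi> p_lo"
    and "p_up > 0" and "uniformly_upper_type M \<phi> p_up"
    and "\<And>t. t > 0 \<Longrightarrow> (\<integral>\<^sup>+x. ennreal (\<phi> x t) \<partial>M) < \<infinity>"
    and "h \<in> borel_measurable M"
    and "\<And>n. hn n \<in> wl_space M \<phi>"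
    and "AE x in M. (\<lambda>n. hn n x) \<longlonglongrightarrow> h x"
    and "K > 0" and "\<And>n. AE x in M. \<bar>hn n x\<bar> \<le> K"
  shows "(\<lambda>n. wl_norm M \<phi> (\<lambda>x. hn n x - h x)) \<longlonglongrightarrow> 0"
proof -
  note mo = assms(2) and lim = assms(10)
  define f where "f n x = hn n x - h x" for n x
  obtain C where C: "C > 0"
    "\<forall>x\<in>space M. \<forall>t\<ge>0. \<forall>s\<in>{0<..<1}. \<phi> x (s * t) \<le> C * s powr p_lo * \<phi> x t"
    using assms(4) unfolding uniformly_lower_type_def by blast
  have meas: "f n \<in> borel_measurable M" for n
    using assms(8) assms(9)[of n] by (auto simp: f_def[abs_def] wl_space_def)
  have f_lim: "AE x in M. (\<lambda>n. f n x) \<longlonglongrightarrow> 0"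
    using lim by eventually_elim (simp add: f_def LIM_zero)
  \<comment> \<open>One null set has to serve all \<open>n\<close>, so that the bound passes to the
    pointwise limit \<open>h\<close>.\<close>
  have "AE x in M. \<forall>n. \<bar>hn n x\<bar> \<le> K"
    using assms(12) by (simp add: AE_all_countable)
  then have h_bound: "AE x in M. \<bar>h x\<bar> \<le> K"
    using lim
  proof eventually_elim
    case (elim x)
    then show ?case
      using tendsto_rabs[OF elim(2)] by (auto intro: LIMSEQ_le_const2)
  qed
  have bound: "AE x in M. \<bar>f n x\<bar> \<le> 2 * K" for n
    using h_bound assms(12)[of n] by eventually_elim (simp add: f_def)
  \<comment> \<open>For fixed \<open>l\<close> the second argument \<open>2 * K / l\<close> is
    constant in \<open>n\<close>, so the integral bound tends to 0. Once it is below 1, the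
    threshold in the definition of the quasi-norm, \<open>l\<close> is admissible for
    \<open>f n\<close>, for all \<alpha> at once.\<close>
  have norm_le: "\<forall>\<^sub>F n in sequentially. wl_norm M \<phi> (f n) \<le> ennreal l" if "l > 0" for l
  proof -
    have "(\<lambda>n. \<integral>\<^sup>+x. ennreal (C * (\<bar>f n x\<bar> / (2 * K)) powr p_lo * \<phi> x (2 * K / l)) \<partial>M) \<longlonglongrightarrow> 0"
      using assms(3,7,11) C(1) that
      by (intro lower_type_bound_tendsto_0 mo meas f_lim bound) auto
    then have "\<forall>\<^sub>F n in sequentially.
        (\<integral>\<^sup>+x. ennreal (C * (\<bar>f n x\<bar> / (2 * K)) powr p_lo * \<phi> x (2 * K / l)) \<partial>M) < 1"
      by (rule order_tendstoD) simp
    then show ?thesis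
    proof eventually_elim
      case (elim n)
      show ?case
      proof (rule wl_norm_le[OF that])
        fix \<alpha> :: real assume "\<alpha> > 0"
        then show "mo_measure M \<phi> {x \<in> space M. \<bar>f n x\<bar> > \<alpha>} (\<alpha> / l) \<le> 1"
          using lower_type_superlevel_le[OF mo C assms(3) _ that _ bound[of n], of \<alpha>] assms(11) elim
          by simp
      qed
    qed
  qed
  have "(\<lambda>n. wl_norm M \<phi> (f n)) \<longlonglongrightarrow> 0"
  proof (rule order_tendstoI)
    fix e :: ennreal assume "0 < e"
    \<comment> \<open>The value \<open>e\<close> may be infinite. An intermediate \<open>d\<close>
      is finite, hence a positive real to which \<open>norm_le\<close> applies, and
      \<open>d < e\<close> makes the final inequality strict.\<close>
    then obtain d where "0 < d" "d < e"
      using dense by blast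
    then obtain l where "d = ennreal l" "l > 0"
      by (cases d) (auto simp: ennreal_less_zero_iff)
    then show "\<forall>\<^sub>F n in sequentially. wl_norm M \<phi> (f n) < e"
      using norm_le[of l] \<open>d < e\<close> by (auto elim: eventually_mono)
  qed simp
  then show ?thesis
    by (simp add: f_def[abs_def])
qed

end
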